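(* Let $\lambda$ be a partition, $R=\mathbb{Z}[x_{ij}\colon(i,j)\in\lambda]$, and let $F=\{(i,j)\colon 1\le i\le d,\ 1\le j\le e\}$ be a $d\times e$ rectangle contained in $\lambda^*$ whose corner square $(d,e)$ lies in $\lambda^*\setminus\lambda$; assume $d\le e$. Let $W_F=(P_{ij})_{(i,j)\in F}$ be the $d\times e$ matrix over $R$. Then there are an upper unitriangular matrix $P\in\mathrm{SL}(d,R)$ and a lower unitriangular matrix $Q\in\mathrm{SL}(e,R)$ such that $$P\cdot W_F\cdot Q=(\mathbf{0},\ \mathrm{diag}(A_{1,1+e-d},A_{2,2+e-d},\dots,A_{d,e})),$$ where $\mathbf{0}$ is the $d\times(e-d)$ zero matrix. In particular, if $\lambda$ has rank $\rho$ and $F$ is the $(\rho+1)\times(\rho+1)$ square, this gives $P\,W_F\,Q=\mathrm{diag}(A_{11},\dots,A_{\rho+1,\rho+1})$.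
   Context: A partition $\lambda=(\lambda_1\ge\dots\ge\lambda_\ell>0)$ is identified with its Young diagram $\{(r,s)\colon 1\le r\le\ell,\ 1\le s\le\lambda_r\}$; its rank $\rho$ is the largest $k$ with $\lambda_k\ge k$. The extended partition $\lambda^*$ is the diagram of the partition with parts $\lambda^*_1=\lambda_1+1$ and $\lambda^*_r=\lambda_{r-1}+1$ for $2\le r\le\ell+1$ (i.e. $\lambda$ together with the border strip from the end of its first row to the end of its first column). To each square $(i,j)\in\lambda$ associate an indeterminate $x_{ij}$. For $(r,s)\in\lambda^*$ let $\lambda(r,s)$ be the partition consisting of squares $(u,v)\in\lambda$ with $u\ge r$, $v\ge s$; define $P_{rs}=\sum_{\mu\subseteq\lambda(r,s)}\prod_{(i,j)\in\lambda(r,s)\setminus\mu}x_{ij}$ (sum over partitions $\mu$ contained in $\lambda(r,s)$) and $A_{rs}=\prod_{(i,j)\in\lambda(r,s)}x_{ij}$; empty products are $1$, so $P_{rs}=A_{rs}=1$ for $(r,s)\in\lambda^*\setminus\lambda$. *)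

theory Defs
  imports
    "HOL-Library.Poly_Mapping"
    "Jordan_Normal_Form.Determinant"
begin

definition is_partition :: "nat list \<Rightarrow> bool" where
  "is_partition la \<longleftrightarrow> sorted_wrt (\<ge>) la \<and> (\<forall>x \<in> set la. 0 < x)"

text \<open>Parts are numbered from 1; \<open>part la k\<close> is 0 for \<open>k = 0\<close> and for \<open>k\<close> beyond the length.\<close>

definition part :: "nat list \<Rightarrow> nat \<Rightarrow> nat" where
  "part la k = (if 1 \<le> k \<and> k \<le> length la then la ! (k - 1) else 0)"

definition diagram :: "nat list \<Rightarrow> (nat \<times> nat) set" where
  "diagram la = {(r, s). 1 \<le> r \<and> r \<le> length la \<and> 1 \<le> s \<and> s \<le> part la r}"

text \<open>\<open>k = 0\<close> satisfies the predicate, and \<open>k \<ge> 1\<close> only if \<open>k \<le> length la\<close>.\<close>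

definition part_rank :: "nat list \<Rightarrow> nat" where
  "part_rank la = (GREATEST k. k \<le> part la k)"

text \<open>For the empty partition the convention \<open>part [] 1 = 0\<close> makes the extended partition
  a single square.\<close>

definition extended :: "nat list \<Rightarrow> nat list" where
  "extended la = Suc (part la 1) # map Suc la"

definition subpart :: "nat list \<Rightarrow> nat \<Rightarrow> nat \<Rightarrow> (nat \<times> nat) set" where
  "subpart la r s = {(u, v) \<in> diagram la. r \<le> u \<and> s \<le> v}"

text \<open>The squares of \<open>subpart la r s\<close> keep their coordinates in \<open>la\<close>, so a partition contained in
  it has to be placed with its top left square at \<open>(r, s)\<close>.\<close>

definition diagram_at :: "nat \<Rightarrow> nat \<Rightarrow> nat list \<Rightarrow> (nat \<times> nat) set" where
  "diagram_at r s mu = (\<lambda>(i, j). (r + i - 1, s + j - 1)) ` diagram mu"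

definition contained_partitions :: "nat list \<Rightarrow> nat \<Rightarrow> nat \<Rightarrow> nat list set" where
  "contained_partitions la r s = {mu. is_partition mu \<and> diagram_at r s mu \<subseteq> subpart la r s}"

text \<open>Integer polynomials in indeterminates indexed by all pairs of naturals;
  \<open>poly_ring la\<close> is the subring of those involving only the indeterminates of squares of \<open>la\<close>.\<close>

type_synonym mpoly = "((nat \<times> nat) \<Rightarrow>\<^sub>0 nat) \<Rightarrow>\<^sub>0 int"

definition X :: "nat \<times> nat \<Rightarrow> mpoly" where
  "X ij = Poly_Mapping.single (Poly_Mapping.single ij 1) 1"

definition poly_ring :: "nat list \<Rightarrow> mpoly set" where
  "poly_ring la = {p. \<forall>m \<in> Poly_Mapping.keys p. Poly_Mapping.keys m \<subseteq> diagram la}"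

definition P :: "nat list \<Rightarrow> nat \<Rightarrow> nat \<Rightarrow> mpoly" where
  "P la r s = (\<Sum>mu \<in> contained_partitions la r s. \<Prod>ij \<in> subpart la r s - diagram_at r s mu. X ij)"

definition A :: "nat list \<Rightarrow> nat \<Rightarrow> nat \<Rightarrow> mpoly" where
  "A la r s = (\<Prod>ij \<in> subpart la r s. X ij)"

definition SL :: "nat \<Rightarrow> 'a :: comm_ring_1 set \<Rightarrow> 'a mat set" where
  "SL n R = {M \<in> carrier_mat n n. elements_mat M \<subseteq> R \<and> det M = 1}"

definition upper_unitriangular :: "'a :: {zero, one} mat \<Rightarrow> bool" where
  "upper_unitriangular M \<longleftrightarrow>
     square_mat M \<and> upper_triangular M \<and> (\<forall>i < dim_row M. M $$ (i, i) = 1)"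

definition lower_unitriangular :: "'a :: {zero, one} mat \<Rightarrow> bool" where
  "lower_unitriangular M \<longleftrightarrow> upper_unitriangular (transpose_mat M)"

definition append_cols :: "'a :: zero mat \<Rightarrow> 'a mat \<Rightarrow> 'a mat" where
  "append_cols M N = four_block_mat M N (0\<^sub>m 0 (dim_col M)) (0\<^sub>m 0 (dim_col N))"

definition rectangle :: "nat \<Rightarrow> nat \<Rightarrow> (nat \<times> nat) set" where
  "rectangle d e = {1..d} \<times> {1..e}"

text \<open>Matrix indices start at 0, squares at \<open>(1, 1)\<close>.\<close>

definition W :: "nat list \<Rightarrow> nat \<Rightarrow> nat \<Rightarrow> mpoly mat" where
  "W la d e = mat d e (\<lambda>(i, j). P la (i + 1) (j + 1))"

lemma finite_diagram: "finite (diagram la)"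
proof -
  have "diagram la \<subseteq> (SIGMA r:{..length la}. {..part la r})"
    by (auto simp: diagram_def)
  then show ?thesis
    by (rule finite_subset) auto
qed

lemma finite_subpart: "finite (subpart la r s)"
  by (rule finite_subset[OF _ finite_diagram[of la]]) (auto simp: subpart_def)

lemma finite_contained_partitions:
  assumes "1 \<le> r" "1 \<le> s"
  shows "finite (contained_partitions la r s)"
proof -
  define N where "N = length la + sum_list la"
  have part_le: "part la k \<le> sum_list la" for k
    by (auto simp: part_def intro!: member_le_sum_list)
  have bound: "i \<le> N \<and> j \<le> N"
    if mu: "mu \<in> contained_partitions la r s" and ij: "(i, j) \<in> diagram mu" for mu i j
  proof -
    have "(r + i - 1, s + j - 1) \<in> diagram_at r s mu"
      using ij by (force simp: diagram_at_def)
    then have "(r + i - 1, s + j - 1) \<in> diagram la"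
      using mu by (auto simp: contained_partitions_def subpart_def)
    then show ?thesis
      using assms part_le[of "r + i - 1"] by (auto simp: diagram_def N_def)
  qed
  have "contained_partitions la r s \<subseteq> {mu. set mu \<subseteq> {..N} \<and> length mu \<le> N}"
  proof (rule subsetI, rule CollectI, rule conjI)
    fix mu assume mu: "mu \<in> contained_partitions la r s"
    have in_diag: "(Suc k, mu ! k) \<in> diagram mu" if "k < length mu" for k
    proof -
      have "0 < mu ! k"
        using mu that by (auto simp: contained_partitions_def is_partition_def)
      then show ?thesis
        using that by (simp add: diagram_def part_def)
    qed
    show "set mu \<subseteq> {..N}"
    proof
      fix x assume "x \<in> set mu"
      then obtain k where "k < length mu" "x = mu ! k"
        by (auto simp: in_set_conv_nth)
      then show "x \<in> {..N}"
        using bound[OF mu in_diag] by simp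
    qed
    show "length mu \<le> N"
    proof (cases "length mu")
      case (Suc k)
      then show ?thesis
        using bound[OF mu in_diag[of k]] by simp
    qed simp
  qed
  then show ?thesis
    by (rule finite_subset) (rule finite_lists_length_le, simp)
qed

end

theory Submission
  imports Defs
begin

text \<open>
  Write \<open>e = d + t\<close>. A partition contained in \<open>\<lambda>(r, s)\<close> is the same as an order ideal of its
  squares. Let \<open>(m, m + t)\<close> be the first square, among those with \<open>m \<ge> r\<close> and \<open>m + t \<ge> s\<close>, that
  the ideal misses; \<open>m \<le> d\<close> because \<open>(d, e)\<close> is not in \<open>\<lambda>\<close>. The ideal then contains the whole
  rectangle to the upper left of \<open>(m, m + t)\<close>, avoids \<open>\<lambda>(m, m + t)\<close>, and is otherwise an arbitrary
  pair of ideals: one in the squares right of the rectangle (depending on \<open>r\<close> and \<open>m\<close> only), one in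
  the squares below it (depending on \<open>s\<close> and \<open>m\<close> only). Hence
  \<open>P\<^sub>r\<^sub>s = (\<Sum>m. U\<^sub>r\<^sub>m * A\<^sub>m\<^sub>,\<^sub>m\<^sub>+\<^sub>t * L\<^sub>m\<^sub>s)\<close>, where \<open>U\<close> is upper unitriangular and \<open>L\<close>
  consists of the last \<open>d\<close> rows of a lower unitriangular matrix. The required matrices are the
  inverses of these two factors.
\<close>

section \<open>Partitions and order ideals\<close>

lemma part_antimono:
  assumes "is_partition la" "1 \<le> i" "i \<le> j"
  shows "part la j \<le> part la i"
proof (cases "i = j \<or> length la < j")
  case True
  then show ?thesis by (auto simp: part_def)
next
  case False
  then have "la ! (i - 1) \<ge> la ! (j - 1)"
    using assms by (intro sorted_wrt_nth_less[of "(\<ge>)"]) (auto simp: is_partition_def)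
  then show ?thesis using False assms by (simp add: part_def)
qed

text \<open>Beyond the length \<open>part\<close> is 0, so \<open>1 <= j <= part la i\<close>
  already bounds \<open>i\<close>.\<close>

lemma mem_diagram_iff: "(i, j) \<in> diagram la \<longleftrightarrow> 1 \<le> i \<and> 1 \<le> j \<and> j \<le> part la i"
  by (auto simp: diagram_def part_def)

lemma diagram_down_closed:
  assumes "is_partition la" "(i, j) \<in> diagram la" "1 \<le> k" "k \<le> i" "1 \<le> l" "l \<le> j"
  shows "(k, l) \<in> diagram la"
  using assms part_antimono[of la k i] by (auto simp: mem_diagram_iff)

lemma mem_subpart_iff: "(i, j) \<in> subpart la r s \<longleftrightarrow> (i, j) \<in> diagram la \<and> r \<le> i \<and> s \<le> j"
  by (auto simp: subpart_def)

lemma mem_diagram_at_iff: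
  assumes "1 \<le> r" "1 \<le> s"
  shows "(i, j) \<in> diagram_at r s mu \<longleftrightarrow> r \<le> i \<and> s \<le> j \<and> (i + 1 - r, j + 1 - s) \<in> diagram mu"
proof
  assume "(i, j) \<in> diagram_at r s mu"
  then obtain u v where "(u, v) \<in> diagram mu" "i = r + u - 1" "j = s + v - 1"
    by (auto simp: diagram_at_def)
  moreover from this have "1 \<le> u" "1 \<le> v" by (auto simp: mem_diagram_iff)
  ultimately have "r \<le> i" "s \<le> j" "i + 1 - r = u" "j + 1 - s = v" "(u, v) \<in> diagram mu"
    by linarith+
  then show "r \<le> i \<and> s \<le> j \<and> (i + 1 - r, j + 1 - s) \<in> diagram mu" by simp
next
  assume "r \<le> i \<and> s \<le> j \<and> (i + 1 - r, j + 1 - s) \<in> diagram mu"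
  then show "(i, j) \<in> diagram_at r s mu"
    using assms by (auto simp: diagram_at_def intro!: image_eqI[of _ _ "(i + 1 - r, j + 1 - s)"])
qed

text \<open>Parts are positive, so the length can be read off \<open>part\<close>: it is the last
  index with a nonzero value.\<close>

lemma partition_eqI:
  assumes mu: "is_partition mu" and nu: "is_partition nu"
    and eq: "\<And>k. 1 \<le> k \<Longrightarrow> part mu k = part nu k"
  shows "mu = nu"
proof -
  have part_pos: "0 < part la k \<longleftrightarrow> k \<le> length la" if "is_partition la" "1 \<le> k" for la k
    using that by (auto simp: part_def is_partition_def)
  have "k \<le> length mu \<longleftrightarrow> k \<le> length nu" if "1 \<le> k" for k
    using part_pos[OF mu that] part_pos[OF nu that] eq[OF that] by simp
  from this[of "length mu"] this[of "length nu"] have len: "length mu = length nu"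
    by (cases "length mu"; cases "length nu") auto
  moreover have "mu ! k = nu ! k" if "k < length mu" for k
    using eq[of "Suc k"] that len by (simp add: part_def)
  ultimately show ?thesis by (rule nth_equalityI)
qed

lemma inj_on_diagram: "inj_on diagram {mu. is_partition mu}"
proof (rule inj_onI)
  fix mu nu assume *: "mu \<in> {mu. is_partition mu}" "nu \<in> {mu. is_partition mu}"
    "diagram mu = diagram nu"
  show "mu = nu"
  proof (rule partition_eqI)
    fix k :: nat assume "1 \<le> k"
    then have "j \<le> part mu k \<longleftrightarrow> j \<le> part nu k" if "1 \<le> j" for j
      using *(3) that by (metis mem_diagram_iff)
    from this[of "part mu k"] this[of "part nu k"] show "part mu k = part nu k"
      by (cases "part mu k"; cases "part nu k") auto
  qed (use * in auto)
qed

text \<open>Cutting \<open>f\<close> at its first zero leaves positive, weakly decreasing values; by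
  monotonicity all later values are 0, the default of \<open>part\<close>. Note the shift:
  \<open>f 0\<close> is the first part.\<close>

lemma ex_partition_of_rows:
  fixes f :: "nat \<Rightarrow> nat"
  assumes anti: "\<And>i j. i \<le> j \<Longrightarrow> f j \<le> f i" and "f N = 0"
  shows "\<exists>mu. is_partition mu \<and> (\<forall>k. part mu (Suc k) = f k)"
proof -
  define n where "n = (LEAST n. f n = 0)"
  have n: "f n = 0" unfolding n_def using \<open>f N = 0\<close> by (rule LeastI)
  have pos: "0 < f k" if "k < n" for k
    using not_less_Least[OF that[unfolded n_def]] by simp
  define mu where "mu = map f [0..<n]"
  have "is_partition mu"
    using pos anti by (auto simp: mu_def is_partition_def sorted_wrt_iff_nth_less)
  moreover have "part mu (Suc k) = f k" for k
    using anti[of n k] n by (auto simp: mu_def part_def)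
  ultimately show ?thesis by blast
qed

text \<open>Meant for the rows of an ideal: each starts at column \<open>s\<close> without gaps, so
  its size determines it.\<close>

lemma down_closed_nat_set:
  fixes T :: "nat set"
  assumes "finite T" "\<And>j. j \<in> T \<Longrightarrow> s \<le> j" "\<And>j l. j \<in> T \<Longrightarrow> s \<le> l \<Longrightarrow> l \<le> j \<Longrightarrow> l \<in> T"
  shows "T = {s..<s + card T}"
proof (cases "T = {}")
  case False
  define N where "N = Max T"
  have N: "N \<in> T" using assms(1) False unfolding N_def by (rule Max_in)
  have T: "T = {s..<Suc N}"
  proof (intro equalityI subsetI)
    show "j \<in> {s..<Suc N}" if "j \<in> T" for j
      using that assms(1,2) by (simp add: N_def less_Suc_eq_le)
    show "j \<in> T" if "j \<in> {s..<Suc N}" for j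
      using that assms(3)[OF N, of j] by simp
  qed
  then have "card T = Suc N - s" by simp
  then have "s + card T = Suc N" using assms(2)[OF N] by simp
  then show ?thesis using T by argo
qed simp

text \<open>Closure is relative to \<open>S\<close>, so that the notion also applies to sets of
  squares that are not quadrants of a diagram, such as the two regions beside a rectangle.\<close>

definition order_ideals :: "(nat \<times> nat) set \<Rightarrow> (nat \<times> nat) set set" where
  "order_ideals S =
     {I. I \<subseteq> S \<and> (\<forall>i j k l. (i, j) \<in> I \<longrightarrow> (k, l) \<in> S \<longrightarrow> k \<le> i \<longrightarrow> l \<le> j \<longrightarrow> (k, l) \<in> I)}"

definition ideal_sum :: "(nat \<times> nat) set \<Rightarrow> mpoly" where
  "ideal_sum S = (\<Sum>I \<in> order_ideals S. \<Prod>ij \<in> S - I. X ij)"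

lemma order_ideals_subset: "I \<in> order_ideals S \<Longrightarrow> I \<subseteq> S"
  by (simp add: order_ideals_def)

lemma order_idealsD:
  "I \<in> order_ideals S \<Longrightarrow> (i, j) \<in> I \<Longrightarrow> (k, l) \<in> S \<Longrightarrow> k \<le> i \<Longrightarrow> l \<le> j \<Longrightarrow> (k, l) \<in> I"
  unfolding order_ideals_def by blast

lemma finite_order_ideals: "finite S \<Longrightarrow> finite (order_ideals S)"
  by (rule finite_subset[of _ "Pow S"]) (auto simp: order_ideals_def)

lemma ideal_sum_empty: "ideal_sum {} = 1"
proof -
  have "order_ideals {} = {{}}" by (auto simp: order_ideals_def)
  then show ?thesis by (simp add: ideal_sum_def)
qed

text \<open>A shifted diagram is closed towards the upper left. Conversely, the row lengths of an
  ideal decrease weakly and end in 0, hence are the parts of a partition.\<close>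

lemma bij_betw_diagram_at:
  assumes la: "is_partition la" and rs: "1 \<le> r" "1 \<le> s"
  shows "bij_betw (diagram_at r s) (contained_partitions la r s) (order_ideals (subpart la r s))"
proof (rule bij_betw_imageI)
  show "inj_on (diagram_at r s) (contained_partitions la r s)"
  proof (rule inj_onI)
    fix mu nu assume *: "mu \<in> contained_partitions la r s" "nu \<in> contained_partitions la r s"
      "diagram_at r s mu = diagram_at r s nu"
    have "(i, j) \<in> diagram mu \<longleftrightarrow> (i, j) \<in> diagram nu" for i j
    proof (cases "1 \<le> i \<and> 1 \<le> j")
      case True
      then have "r \<le> r + i - 1" "s \<le> s + j - 1" "r + i - 1 + 1 - r = i" "s + j - 1 + 1 - s = j"
        by linarith+
      then have "(r + i - 1, s + j - 1) \<in> diagram_at r s ka \<longleftrightarrow> (i, j) \<in> diagram ka" for ka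
        by (simp add: mem_diagram_at_iff[OF rs])
      then show ?thesis using *(3) by metis
    qed (auto simp: mem_diagram_iff)
    then have "diagram mu = diagram nu" by auto
    then show "mu = nu"
      using * inj_on_diagram by (auto simp: contained_partitions_def inj_on_def)
  qed
  show "diagram_at r s ` contained_partitions la r s = order_ideals (subpart la r s)"
  proof (intro equalityI subsetI)
    fix I assume "I \<in> diagram_at r s ` contained_partitions la r s"
    then obtain mu where mu: "is_partition mu" "diagram_at r s mu \<subseteq> subpart la r s"
      and I: "I = diagram_at r s mu" by (auto simp: contained_partitions_def)
    have "(k, l) \<in> I" if "(i, j) \<in> I" "(k, l) \<in> subpart la r s" "k \<le> i" "l \<le> j" for i j k l
      using that diagram_down_closed[OF mu(1), of "i + 1 - r" "j + 1 - s" "k + 1 - r" "l + 1 - s"]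
      by (auto simp: I mem_diagram_at_iff[OF rs] mem_subpart_iff)
    then show "I \<in> order_ideals (subpart la r s)"
      using mu(2) unfolding order_ideals_def I by blast
  next
    fix I assume I: "I \<in> order_ideals (subpart la r s)"
    have fin: "finite I"
      using order_ideals_subset[OF I] finite_subpart by (rule finite_subset)
    \<comment> \<open>Since \<open>diagram la\<close> is itself closed, every square between
      \<open>(r, s)\<close> and a square of \<open>I\<close> lies in \<open>subpart la r s\<close>,
      so closure needs no separate membership condition.\<close>
    have down: "(k, l) \<in> I" if "(i, j) \<in> I" "r \<le> k" "k \<le> i" "s \<le> l" "l \<le> j" for i j k l
    proof -
      have "(i, j) \<in> diagram la"
        using that order_ideals_subset[OF I] by (auto simp: mem_subpart_iff)
      then have "(k, l) \<in> diagram la"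
        using diagram_down_closed[OF la] that rs by auto
      then show ?thesis using order_idealsD[OF I] that by (auto simp: mem_subpart_iff)
    qed
    have I_ge: "r \<le> i \<and> s \<le> j" if "(i, j) \<in> I" for i j
      using that order_ideals_subset[OF I] by (auto simp: mem_subpart_iff)
    define row where "row i = {j. (i, j) \<in> I}" for i
    define f where "f k = card (row (r + k))" for k
    have fin_row: "finite (row i)" for i
      by (rule finite_subset[of _ "snd ` I"]) (force simp: row_def fin)+
    have row: "row (r + k) = {s..<s + f k}" for k
      unfolding f_def
    proof (rule down_closed_nat_set[OF fin_row])
      show "s \<le> j" if "j \<in> row (r + k)" for j
        using that I_ge unfolding row_def by blast
      show "l \<in> row (r + k)" if "j \<in> row (r + k)" "s \<le> l" "l \<le> j" for j l
        using down[of "r + k" j "r + k" l] that unfolding row_def by simp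
    qed
    have f_anti: "f j \<le> f i" if "i \<le> j" for i j
      unfolding f_def
    proof (rule card_mono[OF fin_row], rule subsetI)
      fix l assume "l \<in> row (r + j)"
      then show "l \<in> row (r + i)"
        using down[of "r + j" l "r + i" l] I_ge[of "r + j" l] that unfolding row_def by simp
    qed
    \<comment> \<open>A row below all of the finite set \<open>I\<close> supplies the zero of
      \<open>f\<close>.\<close>
    obtain N where N: "\<And>i j. (i, j) \<in> I \<Longrightarrow> i < N"
    proof -
      have "finite (fst ` I)" using fin by simp
      then obtain N where "\<forall>i \<in> fst ` I. i < N" using finite_nat_set_iff_bounded by blast
      then show ?thesis using that[of N] by (metis fst_conv imageI)
    qed
    have "row (r + N) = {}" using N by (force simp: row_def)
    then have "f N = 0" by (simp add: f_def)
    from ex_partition_of_rows[of f, OF f_anti this]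
    obtain mu where mu: "is_partition mu" "\<And>k. part mu (Suc k) = f k" by blast
    have "(i, j) \<in> I \<longleftrightarrow> (i, j) \<in> diagram_at r s mu" for i j
    proof (cases "r \<le> i \<and> s \<le> j")
      case True
      have "(i, j) \<in> I \<longleftrightarrow> j \<in> row (r + (i - r))" using True by (simp add: row_def)
      also have "\<dots> \<longleftrightarrow> j < s + f (i - r)" unfolding row using True by simp
      also have "\<dots> \<longleftrightarrow> (i, j) \<in> diagram_at r s mu"
        using True mu(2)[of "i - r"] Suc_diff_le[of r i] Suc_diff_le[of s j]
        by (simp add: mem_diagram_at_iff[OF rs] mem_diagram_iff) arith
      finally show ?thesis .
    qed (use I_ge mem_diagram_at_iff[OF rs] in blast)
    then have "I = diagram_at r s mu" by auto
    then show "I \<in> diagram_at r s ` contained_partitions la r s"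
      using mu(1) order_ideals_subset[OF I] by (auto simp: contained_partitions_def)
  qed
qed

lemma P_eq_ideal_sum:
  assumes "is_partition la" "1 \<le> r" "1 \<le> s"
  shows "P la r s = ideal_sum (subpart la r s)"
  unfolding P_def ideal_sum_def
  using bij_betw_diagram_at[OF assms] by (rule sum.reindex_bij_betw)

section \<open>Splitting an ideal along a diagonal\<close>

text \<open>The column bound \<open>s\<close> does not enter here, nor the row bound
  \<open>r\<close> in \<open>lower_region\<close>; this separation is what yields a matrix product
  later.\<close>

definition right_region :: "nat list \<Rightarrow> nat \<Rightarrow> nat \<Rightarrow> nat \<Rightarrow> (nat \<times> nat) set" where
  "right_region la r m c = {(i, j) \<in> diagram la. r \<le> i \<and> i < m \<and> c \<le> j}"

definition lower_region :: "nat list \<Rightarrow> nat \<Rightarrow> nat \<Rightarrow> nat \<Rightarrow> (nat \<times> nat) set" where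
  "lower_region la s m c = {(i, j) \<in> diagram la. m \<le> i \<and> s \<le> j \<and> j < c}"

text \<open>For \<open>c = m + t\<close>, with \<open>r <= m\<close> and \<open>s <= c\<close>,
  these are the ideals whose first missed square on the diagonal is \<open>(m, c)\<close>.\<close>

definition split_ideals :: "nat list \<Rightarrow> nat \<Rightarrow> nat \<Rightarrow> nat \<Rightarrow> nat \<Rightarrow> (nat \<times> nat) set set" where
  "split_ideals la r s m c =
     {I \<in> order_ideals (subpart la r s). {r..<m} \<times> {s..<c} \<subseteq> I \<and> I \<inter> subpart la m c = {}}"

lemma finite_regions: "finite (right_region la r m c)" "finite (lower_region la s m c)"
  by (rule finite_subset[OF _ finite_diagram[of la]],
      force simp: right_region_def lower_region_def)+

text \<open>The square \<open>(m, c)\<close> cuts the quadrant into four blocks. The rectangle is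
  filled and \<open>subpart la m c\<close> is missed entirely. No square of the right region is
  comparable with one of the lower region, so the ideal restricts to them independently and its
  weight factors.\<close>

lemma sum_split_ideals:
  assumes rect: "{r..<m} \<times> {s..<c} \<subseteq> diagram la" and m: "r \<le> m" and c: "s \<le> c"
  shows "(\<Sum>I \<in> split_ideals la r s m c. \<Prod>ij \<in> subpart la r s - I. X ij)
       = A la m c * ideal_sum (right_region la r m c) * ideal_sum (lower_region la s m c)"
proof -
  define Q where "Q = {r..<m} \<times> {s..<c}"
  define R where "R = right_region la r m c"
  define B where "B = lower_region la s m c"
  define T where "T = subpart la m c"
  define S where "S = subpart la r s"
  have S: "S = Q \<union> R \<union> B \<union> T"
    using rect m c
    by (auto simp: S_def Q_def R_def B_def T_def right_region_def lower_region_def subpart_def)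
  have disj: "Q \<inter> R = {}" "Q \<inter> B = {}" "Q \<inter> T = {}" "R \<inter> B = {}" "R \<inter> T = {}" "B \<inter> T = {}"
    by (auto simp: Q_def R_def B_def T_def right_region_def lower_region_def subpart_def)
  have fin: "finite R" "finite B" "finite T"
    by (auto simp: R_def B_def T_def finite_regions finite_subpart)
  have bij: "bij_betw (\<lambda>(I, J). Q \<union> I \<union> J) (order_ideals R \<times> order_ideals B)
      (split_ideals la r s m c)"
  \<comment> \<open>The inverse only restricts to \<open>R\<close> and \<open>B\<close>, because the
    content of \<open>Q\<close> and \<open>T\<close> is prescribed.\<close>
  proof (rule bij_betw_byWitness[where f' = "\<lambda>I. (I \<inter> R, I \<inter> B)"])
    show "\<forall>x \<in> order_ideals R \<times> order_ideals B.
        (\<lambda>I. (I \<inter> R, I \<inter> B)) ((\<lambda>(I, J). Q \<union> I \<union> J) x) = x"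
      using disj by (auto dest!: order_ideals_subset)
    show "\<forall>I \<in> split_ideals la r s m c. (\<lambda>(I, J). Q \<union> I \<union> J) (I \<inter> R, I \<inter> B) = I"
    proof
      fix I assume "I \<in> split_ideals la r s m c"
      then have "I \<subseteq> S" "Q \<subseteq> I" "I \<inter> T = {}"
        by (auto simp: split_ideals_def S_def Q_def T_def dest: order_ideals_subset)
      then show "(\<lambda>(I, J). Q \<union> I \<union> J) (I \<inter> R, I \<inter> B) = I" unfolding S by auto
    qed
    show "(\<lambda>(I, J). Q \<union> I \<union> J) ` (order_ideals R \<times> order_ideals B) \<subseteq> split_ideals la r s m c"
    proof clarify
      fix I J assume I: "I \<in> order_ideals R" and J: "J \<in> order_ideals B"
      have sub: "I \<subseteq> R" "J \<subseteq> B" using I J by (auto dest: order_ideals_subset)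
      \<comment> \<open>Moving up or left inside \<open>S\<close> from \<open>Q\<close> stays in
        \<open>Q\<close>, from \<open>R\<close> leads to \<open>Q\<close> or \<open>R\<close>, and
        from \<open>B\<close> to \<open>Q\<close> or \<open>B\<close>.\<close>
      have "(k, l) \<in> Q \<union> I \<union> J"
        if ij: "(i, j) \<in> Q \<union> I \<union> J" and kl: "(k, l) \<in> S" "k \<le> i" "l \<le> j" for i j k l
      proof -
        have S': "(k, l) \<in> Q \<or> (k, l) \<in> R \<or> (k, l) \<in> B \<or> (k, l) \<in> T" using kl unfolding S by auto
        consider "(i, j) \<in> Q" | "(i, j) \<in> I" "(i, j) \<in> R" | "(i, j) \<in> J" "(i, j) \<in> B"
          using ij sub by auto
        then show ?thesis
        proof cases
          case 1
          then have "(k, l) \<in> Q" using S' kl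
            by (auto simp: Q_def R_def B_def T_def right_region_def lower_region_def subpart_def)
          then show ?thesis by simp
        next
          case 2
          then have "(k, l) \<in> Q \<or> (k, l) \<in> R" using S' kl
            by (auto simp: Q_def R_def B_def T_def right_region_def lower_region_def subpart_def)
          then show ?thesis using order_idealsD[OF I 2(1) _ kl(2,3)] by auto
        next
          case 3
          then have "(k, l) \<in> Q \<or> (k, l) \<in> B" using S' kl
            by (auto simp: Q_def R_def B_def T_def right_region_def lower_region_def subpart_def)
          then show ?thesis using order_idealsD[OF J 3(1) _ kl(2,3)] by auto
        qed
      qed
      moreover have "Q \<union> I \<union> J \<subseteq> S" using sub unfolding S by auto
      ultimately have "Q \<union> I \<union> J \<in> order_ideals S" unfolding order_ideals_def by blast
      moreover have "(Q \<union> I \<union> J) \<inter> T = {}" using sub disj by auto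
      ultimately show "Q \<union> I \<union> J \<in> split_ideals la r s m c"
        by (auto simp: split_ideals_def S_def Q_def T_def)
    qed
    have restrict: "I \<inter> S' \<in> order_ideals S'" if "I \<in> order_ideals S" "S' \<subseteq> S" for I S'
      using that unfolding order_ideals_def by blast
    have "R \<subseteq> S" "B \<subseteq> S" unfolding S by auto
    then show "(\<lambda>I. (I \<inter> R, I \<inter> B)) ` split_ideals la r s m c \<subseteq> order_ideals R \<times> order_ideals B"
      using restrict by (auto simp: split_ideals_def S_def)
  qed
  have prod_eq: "(\<Prod>ij \<in> S - (Q \<union> I \<union> J). X ij)
      = A la m c * ((\<Prod>ij \<in> R - I. X ij) * (\<Prod>ij \<in> B - J. X ij))"
    if "I \<subseteq> R" "J \<subseteq> B" for I J
  proof -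
    \<comment> \<open>Among the missed squares, those of \<open>T\<close> contribute the factor
      \<open>A la m c\<close>.\<close>
    have "S - (Q \<union> I \<union> J) = T \<union> ((R - I) \<union> (B - J))" using that disj unfolding S by blast
    also have "(\<Prod>ij \<in> \<dots>. X ij) = (\<Prod>ij \<in> T. X ij) * (\<Prod>ij \<in> (R - I) \<union> (B - J). X ij)"
      using fin disj by (intro prod.union_disjoint) auto
    also have "(\<Prod>ij \<in> (R - I) \<union> (B - J). X ij) = (\<Prod>ij \<in> R - I. X ij) * (\<Prod>ij \<in> B - J. X ij)"
      using fin disj by (intro prod.union_disjoint) auto
    finally show ?thesis by (simp add: A_def T_def)
  qed
  have "(\<Sum>I \<in> split_ideals la r s m c. \<Prod>ij \<in> S - I. X ij)
      = (\<Sum>(I, J) \<in> order_ideals R \<times> order_ideals B. \<Prod>ij \<in> S - (Q \<union> I \<union> J). X ij)"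
    by (subst sum.reindex_bij_betw[OF bij, symmetric]) (simp add: case_prod_unfold)
  also have "\<dots> = (\<Sum>(I, J) \<in> order_ideals R \<times> order_ideals B.
      A la m c * ((\<Prod>ij \<in> R - I. X ij) * (\<Prod>ij \<in> B - J. X ij)))"
    by (rule sum.cong) (auto dest!: order_ideals_subset simp: prod_eq)
  also have "\<dots> = A la m c * (ideal_sum R * ideal_sum B)"
    unfolding ideal_sum_def sum_product sum.cartesian_product
    by (simp add: sum_distrib_left case_prod_unfold)
  finally show ?thesis by (simp add: S_def R_def B_def mult.assoc)
qed

text \<open>Ideals are classified by their first missed diagonal square: \<open>corner\<close>
  guarantees one with \<open>m <= d\<close>, and \<open>inner\<close> puts all the rectangles inside
  the diagram. For \<open>d = 1\<close> the only rectangle is empty, hence the guard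
  \<open>2 <= d\<close>.\<close>

lemma P_decomposition:
  assumes la: "is_partition la" and corner: "(d, d + t) \<notin> diagram la"
    and inner: "2 \<le> d \<Longrightarrow> (d - 1, d - 1 + t) \<in> diagram la"
    and r: "1 \<le> r" "r \<le> d" and s: "1 \<le> s" "s \<le> d + t"
  shows "P la r s = (\<Sum>m | r \<le> m \<and> s \<le> m + t \<and> m \<le> d.
    A la m (m + t) * ideal_sum (right_region la r m (m + t))
      * ideal_sum (lower_region la s m (m + t)))"
proof -
  define K where "K = {m. r \<le> m \<and> s \<le> m + t \<and> m \<le> d}"
  define Sp where "Sp m = split_ideals la r s m (m + t)" for m
  have finK: "finite K" by (auto simp: K_def)
  have finSp: "finite (Sp m)" for m
    unfolding Sp_def split_ideals_def by (simp add: finite_order_ideals finite_subpart)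
  have cover: "order_ideals (subpart la r s) = (\<Union>m \<in> K. Sp m)"
  proof
    show "(\<Union>m \<in> K. Sp m) \<subseteq> order_ideals (subpart la r s)"
      by (auto simp: Sp_def split_ideals_def)
    show "order_ideals (subpart la r s) \<subseteq> (\<Union>m \<in> K. Sp m)"
    proof
      fix I assume I: "I \<in> order_ideals (subpart la r s)"
      have sub: "I \<subseteq> subpart la r s" by (rule order_ideals_subset[OF I])
      define Pm where "Pm m \<longleftrightarrow> m \<in> K \<and> (m, m + t) \<notin> I" for m
      define m where "m = (LEAST m. Pm m)"
      have "Pm d" using corner r s sub by (auto simp: Pm_def K_def subpart_def)
      then have m: "Pm m" unfolding m_def by (rule LeastI)
      have mK: "m \<in> K" "(m, m + t) \<notin> I" using m by (auto simp: Pm_def)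
      \<comment> \<open>A square of \<open>I\<close> weakly below and right of
        \<open>(m, m + t)\<close> would force that missed square into \<open>I\<close>.\<close>
      have "I \<inter> subpart la m (m + t) = {}"
      proof (rule ccontr)
        assume "I \<inter> subpart la m (m + t) \<noteq> {}"
        then obtain i j where ij: "(i, j) \<in> I" "(i, j) \<in> diagram la" "m \<le> i" "m + t \<le> j"
          by (auto simp: subpart_def)
        then have "(m, m + t) \<in> diagram la"
          using diagram_down_closed[OF la, of i j m "m + t"] mK r s by (auto simp: K_def)
        then have "(m, m + t) \<in> I"
          using order_idealsD[OF I ij(1) _ ij(3,4)] mK by (auto simp: K_def subpart_def)
        then show False using mK by simp
      qed
      \<comment> \<open>If the rectangle is nonempty, \<open>m - 1\<close> is still in
        \<open>K\<close>. By minimality its diagonal square, the lower right corner of the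
        rectangle, belongs to \<open>I\<close>.\<close>
      moreover have "{r..<m} \<times> {s..<m + t} \<subseteq> I"
      proof clarsimp
        fix i j assume ij: "r \<le> i" "i < m" "s \<le> j" "j < m + t"
        then have "m - 1 \<in> K" using mK by (auto simp: K_def)
        moreover have "\<not> Pm (m - 1)"
          using not_less_Least[of "m - 1" Pm] ij unfolding m_def[symmetric] by auto
        ultimately have *: "(m - 1, m - 1 + t) \<in> I" by (simp add: Pm_def)
        then have "(m - 1, m - 1 + t) \<in> diagram la" using sub by (auto simp: subpart_def)
        then have "(i, j) \<in> diagram la"
          using diagram_down_closed[OF la, of "m - 1" "m - 1 + t" i j] ij r s by auto
        then show "(i, j) \<in> I"
          using order_idealsD[OF I *, of i j] ij by (auto simp: subpart_def)
      qed
      ultimately show "I \<in> (\<Union>m \<in> K. Sp m)" using mK I by (auto simp: Sp_def split_ideals_def)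
    qed
  qed
  have rect: "{r..<m} \<times> {s..<m + t} \<subseteq> diagram la" if "m \<in> K" for m
  proof clarsimp
    fix i j assume ij: "r \<le> i" "i < m" "s \<le> j" "j < m + t"
    then have "(d - 1, d - 1 + t) \<in> diagram la" using inner that r by (auto simp: K_def)
    then show "(i, j) \<in> diagram la"
      using diagram_down_closed[OF la, of "d - 1" "d - 1 + t" i j] ij r s that
      by (auto simp: K_def)
  qed
  \<comment> \<open>For \<open>m < n\<close> the rectangle of \<open>n\<close> contains
    \<open>(m, m + t)\<close>, which the ideals in \<open>Sp m\<close> must miss.\<close>
  have not_both: False if "I \<in> Sp m" "I \<in> Sp n" "m \<in> K" "n \<in> K" "m < n" for I m n
  proof -
    have "(m, m + t) \<in> {r..<n} \<times> {s..<n + t}" using that by (auto simp: K_def)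
    then have "(m, m + t) \<in> I" "(m, m + t) \<in> diagram la"
      using that(2) rect[OF that(4)] by (auto simp: Sp_def split_ideals_def)
    then show False using that(1) by (auto simp: Sp_def split_ideals_def subpart_def)
  qed
  have disj: "Sp m \<inter> Sp n = {}" if "m \<in> K" "n \<in> K" "m \<noteq> n" for m n
    using that not_both[of _ m n] not_both[of _ n m] by (cases m n rule: linorder_cases) auto
  have "P la r s = (\<Sum>I \<in> (\<Union>m \<in> K. Sp m). \<Prod>ij \<in> subpart la r s - I. X ij)"
    using P_eq_ideal_sum[OF la r(1) s(1)] by (simp add: ideal_sum_def cover)
  also have "\<dots> = (\<Sum>m \<in> K. \<Sum>I \<in> Sp m. \<Prod>ij \<in> subpart la r s - I. X ij)"
    using disj by (intro sum.UNION_disjoint finK ballI finSp impI) auto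
  also have "\<dots> = (\<Sum>m \<in> K. A la m (m + t) * ideal_sum (right_region la r m (m + t))
      * ideal_sum (lower_region la s m (m + t)))"
    unfolding Sp_def
    by (intro sum.cong refl sum_split_ideals rect) (auto simp: K_def)
  finally show ?thesis by (simp add: K_def)
qed

section \<open>Unitriangular matrices over the polynomial ring\<close>

lemma poly_ring_0: "0 \<in> poly_ring la" by (simp add: poly_ring_def)

lemma poly_ring_1: "1 \<in> poly_ring la" by (simp add: poly_ring_def)

lemma poly_ring_add: "p \<in> poly_ring la \<Longrightarrow> q \<in> poly_ring la \<Longrightarrow> p + q \<in> poly_ring la"
  using Poly_Mapping.keys_add[of p q] unfolding poly_ring_def by blast

lemma poly_ring_uminus: "p \<in> poly_ring la \<Longrightarrow> - p \<in> poly_ring la"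
  by (simp add: poly_ring_def)

lemma poly_ring_mult:
  assumes "p \<in> poly_ring la" "q \<in> poly_ring la"
  shows "p * q \<in> poly_ring la"
  unfolding poly_ring_def
proof clarify
  fix m i j assume m: "m \<in> Poly_Mapping.keys (p * q)" and ij: "(i, j) \<in> Poly_Mapping.keys m"
  from m Poly_Mapping.keys_mult[of p q] obtain a b
    where "m = a + b" "a \<in> Poly_Mapping.keys p" "b \<in> Poly_Mapping.keys q" by blast
  then show "(i, j) \<in> diagram la"
    using assms ij Poly_Mapping.keys_add[of a b] unfolding poly_ring_def by blast
qed

lemma poly_ring_X: "ij \<in> diagram la \<Longrightarrow> X ij \<in> poly_ring la"
  by (simp add: poly_ring_def X_def)

lemma poly_ring_sum: "(\<And>x. x \<in> S \<Longrightarrow> f x \<in> poly_ring la) \<Longrightarrow> sum f S \<in> poly_ring la"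
  by (induction S rule: infinite_finite_induct) (auto simp: poly_ring_0 poly_ring_add)

lemma poly_ring_prod: "(\<And>x. x \<in> S \<Longrightarrow> f x \<in> poly_ring la) \<Longrightarrow> prod f S \<in> poly_ring la"
  by (induction S rule: infinite_finite_induct) (auto simp: poly_ring_1 poly_ring_mult)

lemma poly_ring_of_sign: "signof p \<in> poly_ring la"
  by (auto simp: sign_def poly_ring_1 poly_ring_uminus)

text \<open>The Leibniz expansion uses only signs, products and sums of entries, under which the
  subring is closed.\<close>

lemma poly_ring_det:
  assumes "M \<in> carrier_mat n n" "elements_mat M \<subseteq> poly_ring la"
  shows "det M \<in> poly_ring la"
proof -
  have "M $$ (i, p i) \<in> poly_ring la" if "p permutes {0..<n}" "i \<in> {0..<n}" for p i
  proof -
    have "p i \<in> {0..<n}" using permutes_in_image[OF that(1), of i] that(2) by blast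
    then have "M $$ (i, p i) \<in> elements_mat M"
      using assms(1) that(2) by (intro elements_matI) auto
    then show ?thesis using assms(2) by blast
  qed
  then show ?thesis
    unfolding det_def'[OF assms(1)]
    by (auto intro!: poly_ring_sum poly_ring_mult poly_ring_prod poly_ring_of_sign)
qed

text \<open>Back substitution: in row \<open>i\<close> of \<open>M * V\<close>, terms with
  \<open>k < i\<close> vanish because of \<open>M\<close> and terms with \<open>k > i\<close>
  because of the rows of \<open>V\<close> already treated, leaving the entry of \<open>V\<close>
  itself.\<close>

lemma upper_unitriangular_right_inverse:
  fixes M V :: "'a :: comm_ring_1 mat"
  assumes M: "M \<in> carrier_mat n n" "upper_unitriangular M" and V: "V \<in> carrier_mat n n"
    and MV: "M * V = 1\<^sub>m n"
  shows "upper_unitriangular V"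
proof -
  have M0: "M $$ (i, j) = 0" if "j < i" "i < n" for i j
    using M that by (auto simp: upper_unitriangular_def)
  have M1: "M $$ (i, i) = 1" if "i < n" for i
    using M that by (auto simp: upper_unitriangular_def)
  have expand: "(M * V) $$ (i, j) = (\<Sum>k = 0..<n. M $$ (i, k) * V $$ (k, j))"
    if "i < n" "j < n" for i j
    using that M(1) V by (auto simp: scalar_prod_def)
  have below: "V $$ (i, j) = 0" if "j < i" "i < n" for i j
    using that
  \<comment> \<open>Induction on \<open>n - i\<close> goes through the rows from the bottom
    up.\<close>
  proof (induction "n - i" arbitrary: i rule: less_induct)
    case less
    have "M $$ (i, k) * V $$ (k, j) = (if k = i then V $$ (i, j) else 0)" if "k < n" for k
    proof (cases k i rule: linorder_cases)
      case greater
      then have "V $$ (k, j) = 0" using less that by simp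
      then show ?thesis using greater by simp
    qed (use that less M0 M1 in auto)
    then have "(M * V) $$ (i, j) = (\<Sum>k = 0..<n. if k = i then V $$ (i, j) else 0)"
      using expand[of i j] less by (simp add: sum.cong)
    also have "\<dots> = V $$ (i, j)" using less by (simp add: sum.delta)
    finally show ?case using MV less by simp
  qed
  have "V $$ (i, i) = 1" if "i < n" for i
  proof -
    have "M $$ (i, k) * V $$ (k, i) = (if k = i then V $$ (i, i) else 0)" if "k < n" for k
      using that \<open>i < n\<close> M0 M1 below by (cases k i rule: linorder_cases) auto
    then have "(M * V) $$ (i, i) = (\<Sum>k = 0..<n. if k = i then V $$ (i, i) else 0)"
      using expand[of i i] that by (simp add: sum.cong)
    also have "\<dots> = V $$ (i, i)" using that by (simp add: sum.delta)
    finally show ?thesis using MV that by simp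
  qed
  then show ?thesis using below V by (auto simp: upper_unitriangular_def)
qed

lemma det_upper_unitriangular:
  fixes M :: "'a :: comm_ring_1 mat"
  assumes "M \<in> carrier_mat n n" "upper_unitriangular M"
  shows "det M = 1"
proof -
  have "diag_mat M = replicate n 1"
    using assms by (auto simp: diag_mat_def upper_unitriangular_def list_eq_iff_nth_eq)
  then show ?thesis
    using assms det_upper_triangular[of M n] by (simp add: upper_unitriangular_def)
qed

text \<open>The determinant is 1, so the adjugate is the inverse; its entries are signed minors and
  thus stay in the subring.\<close>

lemma unitriangular_inverse:
  assumes M: "M \<in> carrier_mat n n" "upper_unitriangular M" "elements_mat M \<subseteq> poly_ring la"
  obtains V where "V \<in> SL n (poly_ring la)" "upper_unitriangular V" "V * M = 1\<^sub>m n"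
proof -
  define V where "V = adj_mat M"
  have V: "V \<in> carrier_mat n n" "M * V = 1\<^sub>m n" "V * M = 1\<^sub>m n"
    using adj_mat[OF M(1)] det_upper_unitriangular[OF M(1,2)] by (auto simp: V_def)
  have upper: "upper_unitriangular V" by (rule upper_unitriangular_right_inverse[OF M(1,2) V(1,2)])
  have "V $$ (i, j) \<in> poly_ring la" if ij: "i < n" "j < n" for i j
  proof -
    have "elements_mat (mat_delete M j i) \<subseteq> poly_ring la"
    proof
      fix x assume "x \<in> elements_mat (mat_delete M j i)"
      then obtain k l where kl: "k < n - 1" "l < n - 1" "x = mat_delete M j i $$ (k, l)"
        using M(1) by (auto simp: elements_mat_def mat_delete_def)
      \<comment> \<open>These are the positions in \<open>M\<close> before row \<open>j\<close> and
        column \<open>i\<close> were deleted.\<close>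
      moreover have "(if k < j then k else Suc k) < n" "(if l < i then l else Suc l) < n"
        using kl by auto
      ultimately have "x \<in> elements_mat M"
        using M(1) by (intro elements_matI[OF M(1), of "if k < j then k else Suc k"
              "if l < i then l else Suc l"]) (auto simp: mat_delete_def)
      then show "x \<in> poly_ring la" using M(3) by blast
    qed
    then have "det (mat_delete M j i) \<in> poly_ring la"
      using M(1) by (intro poly_ring_det[of _ "n - 1"]) auto
    moreover have "(-1) ^ k \<in> poly_ring la" for k
      by (induction k) (auto simp: poly_ring_1 poly_ring_uminus)
    ultimately show ?thesis
      using ij M(1) by (auto simp: V_def adj_mat_def cofactor_def intro: poly_ring_mult)
  qed
  then have "elements_mat V \<subseteq> poly_ring la"
    using V(1) by (auto simp: elements_mat_def)
  then have "V \<in> SL n (poly_ring la)"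
    using V(1) det_upper_unitriangular[OF V(1) upper] by (simp add: SL_def)
  then show ?thesis using that upper V(3) by blast
qed

section \<open>Factorization of the matrix\<close>

lemma ideal_sum_in_poly_ring:
  assumes "S \<subseteq> diagram la"
  shows "ideal_sum S \<in> poly_ring la"
  unfolding ideal_sum_def using assms by (auto intro!: poly_ring_sum poly_ring_prod poly_ring_X)

text \<open>Index \<open>k\<close> stands for the diagonal square in row \<open>m = k + 1\<close>,
  and \<open>i\<close> for \<open>r = i + 1\<close>.\<close>

definition upper_factor :: "nat list \<Rightarrow> nat \<Rightarrow> nat \<Rightarrow> mpoly mat" where
  "upper_factor la d t = mat d d
     (\<lambda>(i, k). if i \<le> k then ideal_sum (right_region la (i + 1) (k + 1) (k + 1 + t)) else 0)"

text \<open>The first \<open>t\<close> rows are met only by the zero block of \<open>middle_factor\<close>; they complete the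
  \<open>d \<times> (d + t)\<close> factor to a unitriangular matrix.\<close>

definition lower_factor :: "nat list \<Rightarrow> nat \<Rightarrow> nat \<Rightarrow> mpoly mat" where
  "lower_factor la d t = mat (d + t) (d + t)
     (\<lambda>(a, j). if a < t then if a = j then 1 else 0
       else if j \<le> a then ideal_sum (lower_region la (j + 1) (a - t + 1) (a + 1)) else 0)"

text \<open>This is the asserted normal form, with \<open>t = e - d\<close>.\<close>

definition middle_factor :: "nat list \<Rightarrow> nat \<Rightarrow> nat \<Rightarrow> mpoly mat" where
  "middle_factor la d t = append_cols (0\<^sub>m d t) (mat_diag d (\<lambda>i. A la (i + 1) (i + 1 + t)))"

lemma factor_carrier:
  "upper_factor la d t \<in> carrier_mat d d"
  "lower_factor la d t \<in> carrier_mat (d + t) (d + t)"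
  "middle_factor la d t \<in> carrier_mat d (d + t)"
  by (auto simp: upper_factor_def lower_factor_def middle_factor_def append_cols_def mat_diag_def)

lemma middle_factor_index:
  assumes "i < d" "a < d + t"
  shows "middle_factor la d t $$ (i, a) = (if a = i + t then A la (i + 1) (i + 1 + t) else 0)"
  using assms by (auto simp: middle_factor_def append_cols_def mat_diag_def)

text \<open>On the diagonal \<open>r = m\<close>, so the region has no rows and its ideal sum is
  1.\<close>

lemma upper_unitriangular_upper_factor: "upper_unitriangular (upper_factor la d t)"
proof -
  have "right_region la r r c = {}" for r c by (auto simp: right_region_def)
  then show ?thesis
    by (auto simp: upper_unitriangular_def upper_factor_def ideal_sum_empty)
qed

text \<open>From row \<open>t\<close> on, a diagonal entry has \<open>s = c\<close>, so its region
  has no columns and the ideal sum is 1.\<close>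

lemma lower_unitriangular_lower_factor: "lower_unitriangular (lower_factor la d t)"
proof -
  have "lower_region la s m s = {}" for s m by (auto simp: lower_region_def)
  then show ?thesis
    by (auto simp: lower_unitriangular_def upper_unitriangular_def lower_factor_def ideal_sum_empty)
qed

lemma upper_factor_in_poly_ring: "elements_mat (upper_factor la d t) \<subseteq> poly_ring la"
proof -
  have "right_region la r m c \<subseteq> diagram la" for r m c by (auto simp: right_region_def)
  from ideal_sum_in_poly_ring[OF this] show ?thesis
    by (auto simp: elements_mat_def upper_factor_def poly_ring_0)
qed

lemma lower_factor_in_poly_ring: "elements_mat (lower_factor la d t) \<subseteq> poly_ring la"
proof -
  have "lower_region la s m c \<subseteq> diagram la" for s m c by (auto simp: lower_region_def)
  from ideal_sum_in_poly_ring[OF this] show ?thesis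
    by (auto simp: elements_mat_def lower_factor_def poly_ring_0 poly_ring_1)
qed

text \<open>This is \<open>P_decomposition\<close> read entrywise, with summation index
  \<open>k = m - 1\<close>.\<close>

lemma W_factorization:
  assumes la: "is_partition la" and corner: "(d, d + t) \<notin> diagram la"
    and inner: "2 \<le> d \<Longrightarrow> (d - 1, d - 1 + t) \<in> diagram la"
  shows "W la d (d + t) = upper_factor la d t * (middle_factor la d t * lower_factor la d t)"
proof -
  note carrier = factor_carrier[of la d t]
  define DL where "DL = middle_factor la d t * lower_factor la d t"
  have "W la d (d + t) = upper_factor la d t * DL"
  proof (rule eq_matI)
    fix i j
    assume "i < dim_row (upper_factor la d t * DL)" "j < dim_col (upper_factor la d t * DL)"
    then have ij: "i < d" "j < d + t" using carrier by (auto simp: DL_def)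
    \<comment> \<open>Row \<open>k\<close> of the middle factor can be nonzero only in column
      \<open>k + t\<close>, which selects row \<open>k + t\<close> of the lower factor.\<close>
    have DL_index: "DL $$ (k, j) = A la (k + 1) (k + 1 + t) * lower_factor la d t $$ (k + t, j)" if k: "k < d" for k
    proof -
      have "DL $$ (k, j)
          = (\<Sum>a = 0..<d + t. middle_factor la d t $$ (k, a) * lower_factor la d t $$ (a, j))"
        using k ij carrier by (auto simp: DL_def scalar_prod_def)
      also have "\<dots> = (\<Sum>a = 0..<d + t. if a = k + t
          then A la (k + 1) (k + 1 + t) * lower_factor la d t $$ (k + t, j) else 0)"
        using k by (intro sum.cong) (auto simp: middle_factor_index)
      finally show ?thesis using k by (simp add: sum.delta)
    qed
    have carrier': "DL \<in> carrier_mat d (d + t)"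
      using carrier by (auto simp: DL_def)
    have "(upper_factor la d t * DL) $$ (i, j)
        = (\<Sum>k = 0..<d. upper_factor la d t $$ (i, k) * DL $$ (k, j))"
      using ij carrier(1) carrier' by (auto simp: scalar_prod_def)
    also have "\<dots> = (\<Sum>k = 0..<d. if i \<le> k \<and> j \<le> k + t
        then A la (k + 1) (k + 1 + t) * ideal_sum (right_region la (i + 1) (k + 1) (k + 1 + t))
          * ideal_sum (lower_region la (j + 1) (k + 1) (k + 1 + t)) else 0)"
      using ij by (intro sum.cong)
        (auto simp: DL_index upper_factor_def lower_factor_def ac_simps)
    also have "\<dots> = (\<Sum>k | i \<le> k \<and> j \<le> k + t \<and> k < d.
        A la (k + 1) (k + 1 + t) * ideal_sum (right_region la (i + 1) (k + 1) (k + 1 + t))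
          * ideal_sum (lower_region la (j + 1) (k + 1) (k + 1 + t)))"
      by (rule sum.mono_neutral_cong_right) auto
    also have "\<dots> = P la (i + 1) (j + 1)"
    proof -
      have "P la (i + 1) (j + 1) = (\<Sum>m | i + 1 \<le> m \<and> j + 1 \<le> m + t \<and> m \<le> d.
          A la m (m + t) * ideal_sum (right_region la (i + 1) m (m + t))
            * ideal_sum (lower_region la (j + 1) m (m + t)))"
        by (rule P_decomposition[OF la corner inner]) (use ij in auto)
      then show ?thesis
        by (auto intro: sum.reindex_bij_witness[where i = "\<lambda>m. m - 1" and j = Suc])
    qed
    finally show "W la d (d + t) $$ (i, j) = (upper_factor la d t * DL) $$ (i, j)"
      using ij by (simp add: W_def)
  qed (use carrier in \<open>auto simp: W_def DL_def\<close>)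
  then show ?thesis by (simp add: DL_def)
qed

text \<open>Multiplying the factorization by the inverses of the outer factors leaves the middle
  one.\<close>

lemma W_diagonalization:
  assumes la: "is_partition la" and corner: "(d, d + t) \<notin> diagram la"
    and inner: "2 \<le> d \<Longrightarrow> (d - 1, d - 1 + t) \<in> diagram la"
  shows "\<exists>M N. M \<in> SL d (poly_ring la) \<and> upper_unitriangular M \<and>
      N \<in> SL (d + t) (poly_ring la) \<and> lower_unitriangular N \<and>
      M * W la d (d + t) * N = middle_factor la d t"
proof -
  note carrier = factor_carrier[of la d t]
  obtain M where M: "M \<in> SL d (poly_ring la)" "upper_unitriangular M"
      "M * upper_factor la d t = 1\<^sub>m d"
    using unitriangular_inverse[OF carrier(1) upper_unitriangular_upper_factor
        upper_factor_in_poly_ring] .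
  \<comment> \<open>Transposition reduces the lower factor to the upper triangular case and turns
    the left inverse obtained there into a right inverse.\<close>
  have "elements_mat (transpose_mat (lower_factor la d t)) = elements_mat (lower_factor la d t)"
    by (auto simp: elements_mat_def)
  then obtain V where V: "V \<in> SL (d + t) (poly_ring la)" "upper_unitriangular V"
      "V * transpose_mat (lower_factor la d t) = 1\<^sub>m (d + t)"
    using unitriangular_inverse[of "transpose_mat (lower_factor la d t)" "d + t" la]
      carrier(2) lower_unitriangular_lower_factor[of la d t] lower_factor_in_poly_ring[of la d t]
    unfolding lower_unitriangular_def by (metis transpose_carrier_mat)
  define N where "N = transpose_mat V"
  have MC: "M \<in> carrier_mat d d" and VC: "V \<in> carrier_mat (d + t) (d + t)"
    using M V by (auto simp: SL_def)
  then have NC: "N \<in> carrier_mat (d + t) (d + t)" by (simp add: N_def)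
  have "elements_mat N = elements_mat V" by (auto simp: elements_mat_def N_def)
  then have N: "N \<in> SL (d + t) (poly_ring la)" "lower_unitriangular N"
    using V VC NC by (auto simp: SL_def N_def det_transpose lower_unitriangular_def)
  have "transpose_mat (V * transpose_mat (lower_factor la d t)) = 1\<^sub>m (d + t)"
    using V(3) by simp
  then have LN: "lower_factor la d t * N = 1\<^sub>m (d + t)"
    using carrier(2) VC by (simp add: transpose_mult[of _ "d + t" "d + t"] N_def)
  have "W la d (d + t) = upper_factor la d t * (middle_factor la d t * lower_factor la d t)"
    using la corner inner by (rule W_factorization)
  then have "M * W la d (d + t)
      = (M * upper_factor la d t) * (middle_factor la d t * lower_factor la d t)"
    using carrier MC by (simp add: assoc_mult_mat[of _ d d _ d _ "d + t"])
  also have "\<dots> = middle_factor la d t * lower_factor la d t" using M(3) carrier by simp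
  finally have "M * W la d (d + t) * N = middle_factor la d t * (lower_factor la d t * N)"
    using carrier NC by (simp add: assoc_mult_mat[of _ d "d + t" _ "d + t" _ "d + t"])
  also have "\<dots> = middle_factor la d t" using LN carrier by simp
  finally show ?thesis using M N by blast
qed

section \<open>The extended diagram and the rank\<close>

lemma is_partition_extended: "is_partition la \<Longrightarrow> is_partition (extended la)"
  by (cases la) (auto simp: is_partition_def extended_def part_def sorted_wrt_map)

lemma part_extended_Suc:
  assumes "1 \<le> k" "k \<le> length la"
  shows "part (extended la) (Suc k) = Suc (part la k)"
  using assms by (auto simp: part_def extended_def nth_Cons')

lemma part_extended_1: "part (extended la) (Suc 0) = Suc (part la 1)"
  by (simp add: part_def extended_def)

text \<open>The \<open>GREATEST\<close> is attained: 0 satisfies the predicate and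
  \<open>length la\<close> bounds it. The second claim is maximality.\<close>

lemma part_rank_props:
  assumes "is_partition la"
  shows "part_rank la \<le> part la (part_rank la)"
    "part la (Suc (part_rank la)) \<le> part_rank la"
proof -
  have bound: "k \<le> length la" if "k \<le> part la k" for k
    using that by (auto simp: part_def split: if_splits)
  show "part_rank la \<le> part la (part_rank la)"
    unfolding part_rank_def by (rule GreatestI_nat[of _ 0]) (auto dest: bound)
  have "\<not> Suc (part_rank la) \<le> part la (Suc (part_rank la))"
    using Greatest_le_nat[of "\<lambda>k. k \<le> part la k" "Suc (part_rank la)" "length la"] bound
    unfolding part_rank_def by auto
  then show "part la (Suc (part_rank la)) \<le> part_rank la" by simp
qed

theorem theorem3:
  fixes la :: "nat list"
  assumes "is_partition la"
  shows
    "(\<forall>d e. rectangle d e \<subseteq> diagram (extended la) \<longrightarrow>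
        (d, e) \<in> diagram (extended la) - diagram la \<longrightarrow> d \<le> e \<longrightarrow>
        (\<exists>M N. M \<in> SL d (poly_ring la) \<and> upper_unitriangular M \<and>
               N \<in> SL e (poly_ring la) \<and> lower_unitriangular N \<and>
               M * W la d e * N =
                 append_cols (0\<^sub>m d (e - d))
                   (mat_diag d (\<lambda>i. A la (i + 1) (i + 1 + e - d))))) \<and>
     (let n = part_rank la + 1 in
        rectangle n n \<subseteq> diagram (extended la) \<and>
        (n, n) \<in> diagram (extended la) - diagram la \<and>
        (\<exists>M N. M \<in> SL n (poly_ring la) \<and> upper_unitriangular M \<and>
               N \<in> SL n (poly_ring la) \<and> lower_unitriangular N \<and>
               M * W la n n * N = mat_diag n (\<lambda>i. A la (i + 1) (i + 1))))"
proof -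
  have main: "\<exists>M N. M \<in> SL d (poly_ring la) \<and> upper_unitriangular M \<and>
      N \<in> SL (d + t) (poly_ring la) \<and> lower_unitriangular N \<and>
      M * W la d (d + t) * N = middle_factor la d t"
    if "(d, d + t) \<in> diagram (extended la) - diagram la" for d t
  proof (rule W_diagonalization[OF assms])
    show "(d, d + t) \<notin> diagram la" using that by simp
    assume d: "2 \<le> d"
    have "d \<le> Suc (length la)" "d + t \<le> part (extended la) d"
      using that by (auto simp: diagram_def extended_def)
    \<comment> \<open>Row \<open>d\<close> of the extended diagram is one longer than row
      \<open>d - 1\<close> of \<open>la\<close>, so one step up and left from the corner lies in
      \<open>la\<close>.\<close>
    then have "d + t \<le> Suc (part la (d - 1))"
      using d part_extended_Suc[of "d - 1" la] by auto
    then show "(d - 1, d - 1 + t) \<in> diagram la" using d by (auto simp: mem_diagram_iff)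
  qed
  define n where "n = part_rank la + 1"
  have "n \<le> part (extended la) n"
  \<comment> \<open>Rank 0 is separate because the first row of the extended diagram is not a
    shifted row of \<open>la\<close>.\<close>
  proof (cases "part_rank la = 0")
    case False
    then have "part_rank la \<le> length la"
      using part_rank_props(1)[OF assms] by (auto simp: part_def split: if_splits)
    then show ?thesis
      using part_extended_Suc[of "part_rank la" la] part_rank_props(1)[OF assms] False
      by (simp add: n_def)
  qed (simp add: n_def part_extended_1)
  then have n_ext: "(n, n) \<in> diagram (extended la)" by (simp add: mem_diagram_iff n_def)
  then have "rectangle n n \<subseteq> diagram (extended la)"
    using diagram_down_closed[OF is_partition_extended[OF assms] n_ext]
    by (auto simp: rectangle_def)
  moreover have n_corner: "(n, n) \<in> diagram (extended la) - diagram la"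
    using n_ext part_rank_props(2)[OF assms] by (auto simp: n_def mem_diagram_iff)
  \<comment> \<open>For \<open>t = 0\<close> the zero block has no columns.\<close>
  moreover have "middle_factor la n 0 = mat_diag n (\<lambda>i. A la (i + 1) (i + 1))"
    using factor_carrier(3)[of la n 0]
    by (intro eq_matI) (auto simp: middle_factor_index mat_diag_def)
  moreover have "\<exists>M N. M \<in> SL d (poly_ring la) \<and> upper_unitriangular M \<and>
               N \<in> SL e (poly_ring la) \<and> lower_unitriangular N \<and>
               M * W la d e * N =
                 append_cols (0\<^sub>m d (e - d))
                   (mat_diag d (\<lambda>i. A la (i + 1) (i + 1 + e - d)))"
    if "(d, e) \<in> diagram (extended la) - diagram la" "d \<le> e" for d e
  proof -
    \<comment> \<open>Truncated subtraction: this regrouping relies on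
      \<open>d <= e\<close>.\<close>
    have "i + 1 + e - d = i + 1 + (e - d)" for i using that(2) by simp
    then show ?thesis
      using main[of d "e - d"] that unfolding middle_factor_def by simp
  qed
  ultimately show ?thesis
    using main[of n 0] unfolding Let_def n_def[symmetric] by auto
qed

end
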